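(* Let $d\ge 2$ and let $\Gamma,\widetilde\Gamma$ be $\mathbb Z^d$-periodic graphs whose fundamental graphs $\Gamma_f,\widetilde\Gamma_f$ have the same number $\nu$ of vertices. Let the Schrödinger operators $H=\Delta+Q$ and $\widetilde H=\widetilde\Delta+\widetilde Q$ on $\Gamma$ and $\widetilde\Gamma$, respectively, satisfy both Conditions U and L. Then the spectral bands $\sigma_n=[\lambda_n^-,\lambda_n^+]$, $\widetilde\sigma_n=[\widetilde\lambda_n^-,\widetilde\lambda_n^+]$, $n=1,\ldots,\nu$, and the gaps $\gamma_n=[\lambda_n^+,\lambda_{n+1}^-]$, $\widetilde\gamma_n=[\widetilde\lambda_n^+,\widetilde\lambda_{n+1}^-]$, $n=1,\ldots,\nu-1$, of $H$ and $\widetilde H$ satisfy $$|\lambda_1^--\widetilde\lambda_1^-|+|\lambda_\nu^+-\widetilde\lambda_\nu^+|+\sum_{n=1}^{\nu-1}\big||\gamma_n|-|\widetilde\gamma_n|\big|\le2C,$$ $$\sum_{n=1}^\nu\big||\sigma_n|-|\widetilde\sigma_n|\big|\le2C,$$ where $$C=C(\vartheta_\pm,\widetilde\vartheta_\pm)=\|H(\vartheta_-)-\widetilde H(\widetilde\vartheta_-)\|_1+\|H(\vartheta_+)-\widetilde H(\widetilde\vartheta_+)\|_1,\qquad \|V\|_1=\sum_{j,k=1}^\nu|V_{jk}|,$$ and $\vartheta_\pm,\widetilde\vartheta_\pm\in\mathbb T^d$ are the $H$- and $\widetilde H$-upper/lower quasimomenta, respectively. In particular, $$C=\begin{cases}2\sum_{n=1}^\nu|q_n-\widetilde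 q_n|,&\text{if }\Delta(\vartheta_\pm)=\widetilde\Delta(\widetilde\vartheta_\pm),\\[4pt] \sum_{\pm}\|\Delta(\vartheta_\pm)-\widetilde\Delta(\widetilde\vartheta_\pm)\|_1,&\text{if }Q=\widetilde Q\ \ (\text{i.e. } q_n=\widetilde q_n\text{ for all }n).\end{cases}$$
   Context: A $\mathbb Z^d$-periodic graph $\Gamma=(V,\mathcal E)$ ($d\ge2$) is a connected graph embedded in $\mathbb R^d$, possibly with loops and multiple edges, with vertex set $V$ and set $\mathcal E$ of unoriented edges, such that: any bounded domain of $\mathbb R^d$ contains finitely many vertices; every vertex has finite degree (number of incident edges, a loop counted twice); and there is a basis $a_1,\ldots,a_d$ of $\mathbb R^d$ (the periods) with $\Gamma+a_s=\Gamma$ for $s=1,\ldots,d$. Coordinates are taken with some origin and axes along $a_1,\ldots,a_d$, so that $\Gamma+m=\Gamma$ for all $m\in\mathbb Z^d$. Each unoriented edge gives two oriented edges $(u,v)$ and $(v,u)$ (an unoriented loop gives two oriented loops); $\mathcal A$ is the set of oriented edges. The fundamental graph is $\Gamma_f=\Gamma/\mathbb Z^d$; it is finite, its vertices are identified with $V\cap[0,1)^d=\{v_1,\ldots,v_\nu\}$, and $\mathcal A_f=\mathcal A/\mathbb Z^d$ is its set of oriented edges. Every $v\in V$ is uniquely $v=[v]+\tilde v$ with $[v]\in\mathbb Z^d$, $\tilde v\in V\cap[0,1)^d$. The index of $\mathbf e=(u,v)\in\mathcal A$ is $\tau(\mathbf e)=[v]-[u]\in\mathbb Z^d$; it is $\mathbb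 Z^d$-translation invariant and defines the index of the corresponding edge of $\mathcal A_f$. $(\Delta f)(v)=\sum_{(v,u)_e\in\mathcal E}(f(v)-f(u))$ on $\ell^2(V)$; $Q$ is multiplication by a real function with $Q(v+m)=Q(v)$, $m\in\mathbb Z^d$; $q_j=Q(v_j)$; $H=\Delta+Q$. The Floquet matrices, for $\vartheta\in\mathbb T^d=\mathbb R^d/(2\pi\mathbb Z)^d$, are $H(\vartheta)=\Delta(\vartheta)+\mathrm{diag}(q_1,\ldots,q_\nu)$, $\Delta_{jk}(\vartheta)=\varkappa_j\delta_{jk}-\sum_{\mathbf e=(v_j,v_k)\in\mathcal A_f}e^{i\langle\tau(\mathbf e),\vartheta\rangle}$, $\varkappa_j=\deg v_j$. The eigenvalues of $H(\vartheta)$ are $\lambda_1(\vartheta)\le\ldots\le\lambda_\nu(\vartheta)$ (with multiplicity), and the spectral bands are $\sigma_n=\sigma_n(H)=[\lambda_n^-,\lambda_n^+]=\lambda_n(\mathbb T^d)$. Objects for $\widetilde\Gamma,\widetilde H$ carry a tilde. Condition U: there is $\vartheta_+\in\mathbb T^d$ with $\lambda_n^+=\lambda_n(\vartheta_+)$ for all $n=1,\ldots,\nu$ (the $H$-upper quasimomentum). Condition L: there is $\vartheta_-\in\mathbb T^d$ with $\lambda_n^-=\lambda_n(\vartheta_-)$ for all $n=1,\ldots,\nu$ (the $H$-lower quasimomentum). Lengths: $|\sigma_n|=\lambda_n^+-\lambda_n^-$ and $|\gamma_n|=\lambda_{n+1}^--\lambda_n^+$ (this quantity may be negative if consecutive bands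 overlap). *)

theory Defs
  imports
    "HOL-Analysis.Analysis"
    "HOL-Computational_Algebra.Computational_Algebra"
    "Jordan_Normal_Form.Char_Poly"
    "Graph_Theory.Graph_Theory"
begin

text \<open>
  A multigraph is given by its set of oriented edges: a \<^typ>\<open>('a, 'b) pre_digraph\<close> together with a
  fixed-point-free involution \<open>flip\<close> that exchanges the two orientations of an edge (locale
  \<^locale>\<open>bidirected_digraph\<close>).  An unoriented edge is a pair \<open>{e, flip e}\<close>; a loop also
  consists of two oriented edges.  The vertices are points of \<open>real ^ 'd\<close>;
  \<open>shift m\<close> is the translation by \<open>\<Sum>s. m $ s *\<^sub>R period s\<close> on the oriented edges.  It has to
  be part of the data because parallel edges are not determined by their end points.
\<close>

record ('d, 'e) embedded_graph =
  graph :: "(real ^ 'd, 'e) pre_digraph"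
  flip :: "'e \<Rightarrow> 'e"
  shift :: "int ^ 'd \<Rightarrow> 'e \<Rightarrow> 'e"
  origin :: "real ^ 'd"
  period :: "'d \<Rightarrow> real ^ 'd"

definition lattice_vec :: "('d::finite, 'e) embedded_graph \<Rightarrow> int ^ 'd \<Rightarrow> real ^ 'd" where
  "lattice_vec G m = (\<Sum>s\<in>UNIV. of_int (vec_nth m s) *\<^sub>R period G s)"

locale periodic_graph =
  bidirected_digraph "graph G" "flip G" for G :: "('d::finite, 'e) embedded_graph" +
  assumes connected_graph: "Digraph_Component.connected (graph G)"
    and discrete: "\<And>B. bounded B \<Longrightarrow> finite (verts (graph G) \<inter> B)"
    and finite_degree: "\<And>v. v \<in> verts (graph G) \<Longrightarrow> finite (out_arcs (graph G) v)"
    and inj_period: "inj (period G)"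
    and independent_period: "independent (range (period G))"
    and span_period: "span (range (period G)) = UNIV"
    and vertex_shift:
      "\<And>m v. v \<in> verts (graph G) \<Longrightarrow> v + lattice_vec G m \<in> verts (graph G)"
    and shift_arcs: "\<And>m e. e \<in> arcs (graph G) \<Longrightarrow> shift G m e \<in> arcs (graph G)"
    and shift_0: "\<And>e. e \<in> arcs (graph G) \<Longrightarrow> shift G 0 e = e"
    and shift_add:
      "\<And>m n e. e \<in> arcs (graph G) \<Longrightarrow> shift G (m + n) e = shift G m (shift G n e)"
    and tail_shift:
      "\<And>m e. e \<in> arcs (graph G) \<Longrightarrow>
        tail (graph G) (shift G m e) = tail (graph G) e + lattice_vec G m"
    and head_shift:
      "\<And>m e. e \<in> arcs (graph G) \<Longrightarrow>
        head (graph G) (shift G m e) = head (graph G) e + lattice_vec G m"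
    and flip_shift:
      "\<And>m e. e \<in> arcs (graph G) \<Longrightarrow> flip G (shift G m e) = shift G m (flip G e)"

text \<open>
  Coordinates with respect to the origin and the periods; in these coordinates the period lattice
  is \<open>\<int>\<^sup>d\<close>, and the decomposition of a vertex \<open>v\<close> into \<open>[v] + v\<^sup>~\<close> is
  \<open>v = lattice_vec G (int_part G v) + cell_part G v\<close>.
\<close>

definition coord :: "('d::finite, 'e) embedded_graph \<Rightarrow> real ^ 'd \<Rightarrow> 'd \<Rightarrow> real" where
  "coord G v s = representation (range (period G)) (v - origin G) (period G s)"

definition int_part :: "('d::finite, 'e) embedded_graph \<Rightarrow> real ^ 'd \<Rightarrow> int ^ 'd" where
  "int_part G v = (\<chi> s. \<lfloor>coord G v s\<rfloor>)"

definition cell_part :: "('d::finite, 'e) embedded_graph \<Rightarrow> real ^ 'd \<Rightarrow> real ^ 'd" where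
  "cell_part G v = v - lattice_vec G (int_part G v)"

definition index :: "('d::finite, 'e) embedded_graph \<Rightarrow> 'e \<Rightarrow> int ^ 'd" where
  "index G e = int_part G (head (graph G) e) - int_part G (tail (graph G) e)"

text \<open>
  The fundamental graph.  Its oriented edges are the orbits of oriented edges under
  translations, and the index and the end points (modulo translations) are constant on each orbit,
  so that the sets under \<^const>\<open>the_elem\<close> are singletons.
\<close>

definition edge_orbit :: "('d::finite, 'e) embedded_graph \<Rightarrow> 'e \<Rightarrow> 'e set" where
  "edge_orbit G e = range (\<lambda>m. shift G m e)"

definition fundamental_graph ::
    "('d::finite, 'e) embedded_graph \<Rightarrow> (real ^ 'd, 'e set) pre_digraph" where
  "fundamental_graph G =
    \<lparr> verts = {v \<in> verts (graph G). \<forall>s. coord G v s \<in> {0..<1}},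
      arcs = edge_orbit G ` arcs (graph G),
      tail = (\<lambda>X. the_elem ((\<lambda>e. cell_part G (tail (graph G) e)) ` X)),
      head = (\<lambda>X. the_elem ((\<lambda>e. cell_part G (head (graph G) e)) ` X)) \<rparr>"

definition orbit_index :: "('d::finite, 'e) embedded_graph \<Rightarrow> 'e set \<Rightarrow> int ^ 'd" where
  "orbit_index G X = the_elem (index G ` X)"

definition periodic_potential ::
    "('d::finite, 'e) embedded_graph \<Rightarrow> (real ^ 'd \<Rightarrow> real) \<Rightarrow> bool" where
  "periodic_potential G Q \<longleftrightarrow>
    (\<forall>v \<in> verts (graph G). \<forall>m. Q (v + lattice_vec G m) = Q v)"

text \<open>
  A numbering \<open>v\<^sub>1, \<dots>, v\<^sub>\<nu>\<close> of the vertices of the fundamental graph is a list.  Vertices,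
  eigenvalues and bands are numbered from \<open>0\<close>, so that position \<open>n\<close> here is number \<open>n + 1\<close> in
  the usual notation.
\<close>

definition vertex_numbering ::
    "('d::finite, 'e) embedded_graph \<Rightarrow> (real ^ 'd) list \<Rightarrow> bool" where
  "vertex_numbering G vs \<longleftrightarrow> distinct vs \<and> set vs = verts (fundamental_graph G)"

text \<open>
  Points of the torus \<open>\<real>\<^sup>d / (2 \<pi> \<int>)\<^sup>d\<close> are given by representatives \<open>\<theta> :: real ^ 'd\<close>.  The number of
  oriented edges leaving a vertex is its degree, with loops counted twice.
\<close>

definition floquet_laplacian ::
    "('d::finite, 'e) embedded_graph \<Rightarrow> (real ^ 'd) list \<Rightarrow> real ^ 'd \<Rightarrow> complex mat" where
  "floquet_laplacian G vs \<theta> = Matrix.mat (length vs) (length vs) (\<lambda>(j, k).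
     (if j = k then of_nat (out_degree (graph G) (vs ! j)) else 0) -
     (\<Sum>X | X \<in> arcs (fundamental_graph G) \<and> tail (fundamental_graph G) X = vs ! j
                                            \<and> head (fundamental_graph G) X = vs ! k.
        exp (\<i> * of_real (\<Sum>s\<in>UNIV. of_int (vec_nth (orbit_index G X) s) * vec_nth \<theta> s))))"

definition floquet_matrix ::
    "('d::finite, 'e) embedded_graph \<Rightarrow> (real ^ 'd \<Rightarrow> real) \<Rightarrow> (real ^ 'd) list \<Rightarrow>
      real ^ 'd \<Rightarrow> complex mat" where
  "floquet_matrix G Q vs \<theta> =
    floquet_laplacian G vs \<theta> + mat_diag (length vs) (\<lambda>j. of_real (Q (vs ! j)))"

text \<open>
  Eigenvalues of a Hermitian matrix in increasing order, repeated according to multiplicity.  They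
  are real, so that \<^const>\<open>Re\<close> only serves to change the type.
\<close>

definition sorted_eigenvalues :: "complex mat \<Rightarrow> real list" where
  "sorted_eigenvalues A = sorted_list_of_multiset (image_mset Re (proots (char_poly A)))"

definition band_function ::
    "('d::finite, 'e) embedded_graph \<Rightarrow> (real ^ 'd \<Rightarrow> real) \<Rightarrow> (real ^ 'd) list \<Rightarrow>
      nat \<Rightarrow> real ^ 'd \<Rightarrow> real" where
  "band_function G Q vs n \<theta> = sorted_eigenvalues (floquet_matrix G Q vs \<theta>) ! n"

definition band_min ::
    "('d::finite, 'e) embedded_graph \<Rightarrow> (real ^ 'd \<Rightarrow> real) \<Rightarrow> (real ^ 'd) list \<Rightarrow> nat \<Rightarrow> real" where
  "band_min G Q vs n = (INF \<theta>. band_function G Q vs n \<theta>)"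

definition band_max ::
    "('d::finite, 'e) embedded_graph \<Rightarrow> (real ^ 'd \<Rightarrow> real) \<Rightarrow> (real ^ 'd) list \<Rightarrow> nat \<Rightarrow> real" where
  "band_max G Q vs n = (SUP \<theta>. band_function G Q vs n \<theta>)"

definition band_length ::
    "('d::finite, 'e) embedded_graph \<Rightarrow> (real ^ 'd \<Rightarrow> real) \<Rightarrow> (real ^ 'd) list \<Rightarrow> nat \<Rightarrow> real" where
  "band_length G Q vs n = band_max G Q vs n - band_min G Q vs n"

text \<open>This is negative if the bands \<open>n\<close> and \<open>n + 1\<close> overlap.\<close>

definition gap_length ::
    "('d::finite, 'e) embedded_graph \<Rightarrow> (real ^ 'd \<Rightarrow> real) \<Rightarrow> (real ^ 'd) list \<Rightarrow> nat \<Rightarrow> real" where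
  "gap_length G Q vs n = band_min G Q vs (n + 1) - band_max G Q vs n"

definition upper_quasimomentum ::
    "('d::finite, 'e) embedded_graph \<Rightarrow> (real ^ 'd \<Rightarrow> real) \<Rightarrow> (real ^ 'd) list \<Rightarrow> real ^ 'd \<Rightarrow> bool" where
  "upper_quasimomentum G Q vs \<theta> \<longleftrightarrow>
    (\<forall>n < length vs. band_max G Q vs n = band_function G Q vs n \<theta>)"

definition lower_quasimomentum ::
    "('d::finite, 'e) embedded_graph \<Rightarrow> (real ^ 'd \<Rightarrow> real) \<Rightarrow> (real ^ 'd) list \<Rightarrow> real ^ 'd \<Rightarrow> bool" where
  "lower_quasimomentum G Q vs \<theta> \<longleftrightarrow>
    (\<forall>n < length vs. band_min G Q vs n = band_function G Q vs n \<theta>)"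

definition condition_U ::
    "('d::finite, 'e) embedded_graph \<Rightarrow> (real ^ 'd \<Rightarrow> real) \<Rightarrow> (real ^ 'd) list \<Rightarrow> bool" where
  "condition_U G Q vs \<longleftrightarrow> (\<exists>\<theta>. upper_quasimomentum G Q vs \<theta>)"

definition condition_L ::
    "('d::finite, 'e) embedded_graph \<Rightarrow> (real ^ 'd \<Rightarrow> real) \<Rightarrow> (real ^ 'd) list \<Rightarrow> bool" where
  "condition_L G Q vs \<longleftrightarrow> (\<exists>\<theta>. lower_quasimomentum G Q vs \<theta>)"

definition entry_norm :: "complex mat \<Rightarrow> real" where
  "entry_norm V = (\<Sum>j<dim_row V. \<Sum>k<dim_col V. cmod (V $$ (j, k)))"

end

theory Submission
  imports Defs "Jordan_Normal_Form.Schur_Decomposition"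
begin

text \<open>
  Everything reduces to the inequality \<open>\<Sum>\<^sub>k |\<lambda>\<^sub>k(A) - \<lambda>\<^sub>k(B)| \<le> \<parallel>A - B\<parallel>\<^sub>1\<close> for Hermitian matrices, applied
  to the Floquet matrices at the lower and at the upper quasimomenta: each gap or band length is a
  difference of two band edges.  For the inequality put \<open>V = A - B\<close> and let \<open>D\<close> be the diagonal matrix
  of the absolute row sums of \<open>V\<close>.  Since \<open>D \<plusminus> V\<close> is diagonally dominant, \<open>M = (A + B + D) / 2\<close>
  dominates both \<open>A\<close> and \<open>B\<close>, so that \<open>\<lambda>\<^sub>k(A)\<close> and \<open>\<lambda>\<^sub>k(B)\<close> are at most \<open>\<lambda>\<^sub>k(M)\<close>, and
  \<open>|\<lambda>\<^sub>k(A) - \<lambda>\<^sub>k(B)| \<le> 2 \<lambda>\<^sub>k(M) - \<lambda>\<^sub>k(A) - \<lambda>\<^sub>k(B)\<close>; summing over \<open>k\<close> gives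
  \<open>tr (2 M - A - B) = tr D = \<parallel>V\<parallel>\<^sub>1\<close>.
\<close>

unbundle no vec_syntax
unbundle no inner_syntax
no_notation fps_nth (infixl \<open>$\<close> 75)

section \<open>Unitary diagonalization of Hermitian matrices\<close>

lemma dim_mat_adjoint [simp]:
  "dim_row (mat_adjoint A) = dim_col A" "dim_col (mat_adjoint A) = dim_row A"
  by (simp_all add: mat_adjoint_def)

lemma mat_adjoint_carrier [simp]:
  "A \<in> carrier_mat n m \<Longrightarrow> mat_adjoint A \<in> carrier_mat m n"
  by (auto intro: carrier_matI)

lemma index_mat_adjoint [simp]:
  "i < dim_col A \<Longrightarrow> j < dim_row A \<Longrightarrow> mat_adjoint A $$ (i, j) = conjugate (A $$ (j, i))"
  by (simp add: mat_adjoint_def mat_of_rows_index)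

lemma mat_adjoint_mult:
  fixes A B :: "complex mat"
  assumes "A \<in> carrier_mat n m" "B \<in> carrier_mat m l"
  shows "mat_adjoint (A * B) = mat_adjoint B * mat_adjoint A"
proof (rule eq_matI)
  fix i j assume "i < dim_row (mat_adjoint B * mat_adjoint A)" "j < dim_col (mat_adjoint B * mat_adjoint A)"
  with assms show "mat_adjoint (A * B) $$ (i, j) = (mat_adjoint B * mat_adjoint A) $$ (i, j)"
    by (auto simp: scalar_prod_def mult.commute intro!: sum.cong)
qed (use assms in auto)

lemma mat_adjoint_mat_adjoint [simp]: "mat_adjoint (mat_adjoint A) = (A :: complex mat)"
  by (rule eq_matI) auto

lemma mult_mat_vec_cscalar_prod:
  fixes A :: "complex mat"
  assumes "A \<in> carrier_mat n m" "x \<in> carrier_vec m" "y \<in> carrier_vec n"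
  shows "(A *\<^sub>v x) \<bullet>c y = x \<bullet>c (mat_adjoint A *\<^sub>v y)"
proof -
  have "(A *\<^sub>v x) \<bullet>c y = (\<Sum>i<n. \<Sum>j<m. A $$ (i, j) * x $ j * cnj (y $ i))"
    using assms by (auto simp: scalar_prod_def sum_distrib_right atLeast0LessThan intro!: sum.cong)
  also have "\<dots> = (\<Sum>j<m. \<Sum>i<n. A $$ (i, j) * x $ j * cnj (y $ i))"
    by (rule sum.swap)
  also have "\<dots> = x \<bullet>c (mat_adjoint A *\<^sub>v y)"
    using assms by (auto simp: scalar_prod_def sum_distrib_left atLeast0LessThan mult_ac intro!: sum.cong)
  finally show ?thesis .
qed

section \<open>Unitary matrices\<close>

definition unitary_mat :: "nat \<Rightarrow> complex mat \<Rightarrow> bool" where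
  "unitary_mat n P \<longleftrightarrow> P \<in> carrier_mat n n \<and> mat_adjoint P * P = 1\<^sub>m n"

text \<open>For square matrices a left inverse is also a right inverse, so the one-sided definition
  yields both identities.\<close>

lemma unitary_matD:
  assumes "unitary_mat n P"
  shows "P \<in> carrier_mat n n" "mat_adjoint P \<in> carrier_mat n n"
    and "mat_adjoint P * P = 1\<^sub>m n" "P * mat_adjoint P = 1\<^sub>m n"
  using assms mat_mult_left_right_inverse[of "mat_adjoint P" n P]
  by (auto simp: unitary_mat_def)

lemma unitary_mat_mult:
  assumes "unitary_mat n P" "unitary_mat n R"
  shows "unitary_mat n (P * R)"
proof -
  note P = unitary_matD[OF assms(1)] and R = unitary_matD[OF assms(2)]
  have "mat_adjoint (P * R) * (P * R) = mat_adjoint R * (mat_adjoint P * P) * R"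
    using P(1,2) R(1,2) by (simp add: mat_adjoint_mult[OF P(1) R(1)] assoc_mult_mat[of _ n n _ n _ n] mult_carrier_mat[of _ n n _ n])
  then show ?thesis
    using P R by (simp add: unitary_mat_def)
qed

lemma unitary_mat_cscalar_prod:
  assumes P: "unitary_mat n P" and "x \<in> carrier_vec n" "y \<in> carrier_vec n"
  shows "(P *\<^sub>v x) \<bullet>c (P *\<^sub>v y) = x \<bullet>c y"
proof -
  note P = unitary_matD[OF P]
  have "(P *\<^sub>v x) \<bullet>c (P *\<^sub>v y) = x \<bullet>c (mat_adjoint P *\<^sub>v (P *\<^sub>v y))"
    using P assms by (intro mult_mat_vec_cscalar_prod[of _ n n]) auto
  also have "mat_adjoint P *\<^sub>v (P *\<^sub>v y) = y"
    using P assms by (simp flip: assoc_mult_mat_vec[of _ n n _ n])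
  finally show ?thesis .
qed

text \<open>Complete \<open>v\<close> to a basis, orthogonalize it and normalize the resulting
  vectors; they are the columns of \<open>W\<close>. This supplies the change of basis for splitting
  off one eigenvector.\<close>

lemma unitary_mat_exists_col:
  assumes v: "v \<in> carrier_vec n" "v \<noteq> 0\<^sub>v n"
  shows "\<exists>W c. unitary_mat n W \<and> c \<noteq> 0 \<and> col W 0 = c \<cdot>\<^sub>v v"
proof -
  interpret cof_vec_space n "TYPE(complex)" .
  have n: "n > 0"
    using v by (cases n) auto
  define b where "b = basis_completion v"
  define ws where "ws = gram_schmidt n b"
  note b = basis_completion[OF v, folded b_def]
  from b(6,7) n obtain vs where bv: "b = v # vs"
    by (cases b) auto
  from gram_schmidt_result[OF b(2,4,5) refl, folded ws_def]
  have ws: "set ws \<subseteq> carrier_vec n" "corthogonal ws" "length ws = n"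
    by (auto simp: b)
  \<comment> \<open>Gram-Schmidt leaves the first vector of the basis unchanged, so the first column
    will be a multiple of \<open>v\<close>.\<close>
  have "hd ws = v"
    using gram_schmidt_hd[OF v(1), of vs] by (simp add: ws_def bv)
  then have ws0: "ws ! 0 = v"
    using ws(3) n by (cases ws) auto
  \<comment> \<open>Gram-Schmidt gives orthogonality only; \<open>r j\<close> is the length of
    \<open>ws ! j\<close>, written as a complex number so that entries can be divided by it. Under
    \<open>Re\<close> stands a number that is real and nonnegative.\<close>
  define r where "r j = complex_of_real (sqrt (Re (ws ! j \<bullet>c ws ! j)))" for j
  have wsc: "ws ! j \<in> carrier_vec n" if "j < n" for j
    using ws that by auto
  have r: "r j * r j = ws ! j \<bullet>c ws ! j" "r j \<noteq> 0" "cnj (r j) = r j" if j: "j < n" for j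
  proof -
    have "ws ! j \<bullet>c ws ! j \<ge> 0"
      by (rule conjugate_square_ge_0_vec)
    moreover have "ws ! j \<bullet>c ws ! j \<noteq> 0"
      using corthogonalD[OF ws(2)] j ws(3) by auto
    ultimately show "r j * r j = ws ! j \<bullet>c ws ! j" "r j \<noteq> 0"  "cnj (r j) = r j"
      by (auto simp: r_def less_eq_complex_def complex_eq_iff simp flip: of_real_mult)
  qed
  define W where "W = Matrix.mat n n (\<lambda>(i, j). ws ! j $ i / r j)"
  have "mat_adjoint W * W = 1\<^sub>m n"
  proof (rule eq_matI)
    fix i j assume ij: "i < dim_row (1\<^sub>m n)" "j < dim_col (1\<^sub>m n)"
    have "(mat_adjoint W * W) $$ (i, j) = (\<Sum>k<n. cnj (ws ! i $ k) * ws ! j $ k / (r i * r j))"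
      using ij r by (auto simp: W_def scalar_prod_def atLeast0LessThan intro!: sum.cong)
    also have "\<dots> = (ws ! j \<bullet>c ws ! i) / (r i * r j)"
      using ij wsc[of i] wsc[of j]
      by (auto simp: scalar_prod_def atLeast0LessThan sum_divide_distrib mult.commute intro!: sum.cong)
    also have "\<dots> = 1\<^sub>m n $$ (i, j)"
      using corthogonalD[OF ws(2), of j i] r[of j] ij ws(3) by auto
    finally show "(mat_adjoint W * W) $$ (i, j) = 1\<^sub>m n $$ (i, j)" .
  qed (auto simp: W_def)
  then have "unitary_mat n W"
    by (simp add: unitary_mat_def W_def)
  moreover have "col W 0 = (1 / r 0) \<cdot>\<^sub>v v"
    using n v ws0 by (intro eq_vecI) (auto simp: W_def)
  ultimately show ?thesis
    using r(2)[OF n] by (intro exI[of _ W] exI[of _ "1 / r 0"]) simp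
qed

text \<open>Deflation, by induction on the list of roots: once an eigenvector is the first basis
  vector, self-adjointness clears the first row as well as the first column, and a smaller Hermitian
  block remains. Since \<open>es\<close> may list the roots in any order, the sorted order can be
  chosen later.\<close>

lemma hermitian_unitary_diagonalization:
  assumes "A \<in> carrier_mat n n" "mat_adjoint A = A"
    and "char_poly A = (\<Prod>e\<leftarrow>es. [:- e, 1:])"
  shows "\<exists>P. unitary_mat n P \<and> A = P * mat_diag n ((!) es) * mat_adjoint P \<and> length es = n"
  using assms
proof (induction es arbitrary: n A)
  case Nil
  then have "n = 0"
    using degree_monic_char_poly[of A n] by auto
  with Nil show ?case
    by (intro exI[of _ "1\<^sub>m 0"]) (auto simp: unitary_mat_def)
next
  case (Cons e es)
  note A = Cons.prems(1)
  note [simp] = assoc_mult_mat[of _ n n _ n _ n] mult_carrier_mat[of _ n n _ n]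
  have mon: "monic (\<Prod>e\<leftarrow>es. [:- e, 1:])"
    by (rule monic_prod_list) auto
  have deg: "degree (char_poly A) = Suc (degree (\<Prod>e\<leftarrow>es. [:- e, 1:]))"
    unfolding Cons.prems(3) using mon by (subst list.map, subst prod_list.Cons, subst degree_mult_eq) auto
  then obtain m where n: "n = Suc m"
    using degree_monic_char_poly[OF A] by auto
  have "eigenvalue A e"
    by (simp add: eigenvalue_root_char_poly[OF A] Cons.prems(3))
  then obtain v where v: "v \<in> carrier_vec n" "v \<noteq> 0\<^sub>v n" "A *\<^sub>v v = e \<cdot>\<^sub>v v"
    using find_eigenvector[OF A] A by (auto simp: eigenvector_def)
  obtain W c where W: "unitary_mat n W" and c: "c \<noteq> 0" "col W 0 = c \<cdot>\<^sub>v v"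
    using unitary_mat_exists_col[OF v(1,2)] by auto
  note W' = unitary_matD[OF W]
  define B where "B = mat_adjoint W * A * W"
  have B: "B \<in> carrier_mat n n"
    using W' A by (auto simp: B_def)
  have A_eq: "A = W * B * mat_adjoint W"
  proof -
    have "W * B * mat_adjoint W = (W * mat_adjoint W) * A * (W * mat_adjoint W)"
      unfolding B_def using A W'(1,2) by simp
    then show ?thesis
      using A by (simp add: W')
  qed
  have B_adj: "mat_adjoint B = B"
    unfolding B_def using A W'(1,2)
    by (simp add: mat_adjoint_mult[of _ n n _ n] Cons.prems(2))
  have W0: "col W 0 \<in> carrier_vec n"
    using W'(1) by auto
  \<comment> \<open>The first column of \<open>W\<close> is an eigenvector of \<open>A\<close> for
    \<open>e\<close>, and \<open>mat_adjoint W\<close> sends it to the first standard basis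
    vector.\<close>
  have "col B 0 = mat_adjoint W *\<^sub>v (A *\<^sub>v col W 0)"
    unfolding B_def using A W'(1,2) n
    by (subst col_mult2[of _ n n _ n]) (auto simp: assoc_mult_mat_vec[OF W'(2) A W0])
  also have "A *\<^sub>v col W 0 = e \<cdot>\<^sub>v col W 0"
    using A v c by (auto simp: mult_mat_vec smult_smult_assoc mult.commute)
  also have "mat_adjoint W *\<^sub>v (e \<cdot>\<^sub>v col W 0) = e \<cdot>\<^sub>v (mat_adjoint W *\<^sub>v col W 0)"
    using W'(1,2) by (intro mult_mat_vec[of _ n n]) auto
  also have "mat_adjoint W *\<^sub>v col W 0 = col (mat_adjoint W * W) 0"
    using W'(1,2) n by (intro col_mult2[symmetric, of _ n n _ n]) auto
  finally have colB: "col B 0 = e \<cdot>\<^sub>v col (1\<^sub>m n) 0"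
    by (simp add: W')
  have B_col: "B $$ (i, 0) = (if i = 0 then e else 0)" if "i < n" for i
    using arg_cong[OF colB, of "\<lambda>v. vec_index v i"] that B n by auto
  have B_row: "B $$ (0, i) = 0" if "0 < i" "i < n" for i
    using arg_cong[OF B_adj, of "\<lambda>M. M $$ (0, i)"] B_col[of i] that B by auto
  define B3 where "B3 = Matrix.mat m m (\<lambda>(i, j). B $$ (Suc i, Suc j))"
  have B3: "B3 \<in> carrier_mat m m"
    by (simp add: B3_def)
  have B_block: "B = four_block_mat (Matrix.mat 1 1 (\<lambda>_. e)) (0\<^sub>m 1 m) (0\<^sub>m m 1) B3"
    using B B_col B_row by (intro eq_matI) (auto simp: n B3_def)
  \<comment> \<open>Similarity and the block form give the characteristic polynomial of
    \<open>A\<close> the factor \<open>[:- e, 1:]\<close>; cancelling it leaves the factorization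
    that the induction hypothesis asks of \<open>B3\<close>.\<close>
  have "similar_mat A B"
    using A B W' A_eq by (intro similar_matI[of _ _ W "mat_adjoint W" n]) auto
  then have "char_poly A = char_poly B"
    by (rule char_poly_similar)
  also have "\<dots> = char_poly (Matrix.mat 1 1 (\<lambda>_. e)) * char_poly B3"
    unfolding B_block by (rule char_poly_four_block_zeros_col[OF _ _ B3]) auto
  also have "char_poly (Matrix.mat 1 1 (\<lambda>_. e)) = [:- e, 1:]"
    by (simp add: char_poly_defs det_def sign_def)
  finally have cp: "char_poly B3 = (\<Prod>e\<leftarrow>es. [:- e, 1:])"
    unfolding Cons.prems(3) by (simp del: mult_pCons_left)
  have "mat_adjoint B3 = B3"
  proof (rule eq_matI)
    fix i j assume "i < dim_row B3" "j < dim_col B3"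
    then show "mat_adjoint B3 $$ (i, j) = B3 $$ (i, j)"
      using arg_cong[OF B_adj, of "\<lambda>M. M $$ (Suc i, Suc j)"] B by (simp add: B3_def n)
  qed (auto simp: B3_def)
  from Cons.IH[OF B3 this cp] obtain P where P: "unitary_mat m P"
    and B3_eq: "B3 = P * mat_diag m ((!) es) * mat_adjoint P" and len: "length es = m"
    by auto
  note P' = unitary_matD[OF P]
  \<comment> \<open>The diagonalizing matrix of the smaller block is extended by the identity on the
    first coordinate; \<open>W * R\<close> then diagonalizes \<open>A\<close>.\<close>
  define R where "R = four_block_mat (1\<^sub>m 1) (0\<^sub>m 1 m) (0\<^sub>m m 1) P"
  have R: "R \<in> carrier_mat n n"
    using P' by (auto simp: R_def n)
  have R_adj: "mat_adjoint R = four_block_mat (1\<^sub>m 1) (0\<^sub>m 1 m) (0\<^sub>m m 1) (mat_adjoint P)"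
    using P'(1) by (intro eq_matI) (auto simp: R_def)
  have D_block: "mat_diag n ((!) (e # es)) =
      four_block_mat (Matrix.mat 1 1 (\<lambda>_. e)) (0\<^sub>m 1 m) (0\<^sub>m m 1) (mat_diag m ((!) es))"
    by (intro eq_matI) (auto simp: mat_diag_def n nth_Cons split: nat.splits)
  have "mat_adjoint R * R = 1\<^sub>m n"
    unfolding R_adj unfolding R_def using P'
    by (subst mult_four_block_mat[of _ 1 1 _ m _ m _ _ 1 _ m]) (auto simp: n four_block_one_mat)
  then have "unitary_mat n R"
    using R by (simp add: unitary_mat_def)
  moreover have "B = R * mat_diag n ((!) (e # es)) * mat_adjoint R"
  proof -
    have D: "mat_diag m ((!) es) \<in> carrier_mat m m"
      by (simp add: mat_diag_def)
    have PD: "P * mat_diag m ((!) es) \<in> carrier_mat m m"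
      using P'(1) D by simp
    have "R * mat_diag n ((!) (e # es)) =
        four_block_mat (Matrix.mat 1 1 (\<lambda>_. e)) (0\<^sub>m 1 m) (0\<^sub>m m 1) (P * mat_diag m ((!) es))"
      unfolding R_def D_block using P'(1) D PD
      by (subst mult_four_block_mat[of _ 1 1 _ m _ m _ _ 1 _ m])
        (auto simp: left_mult_zero_mat[OF D] right_mult_zero_mat[OF P'(1)])
    then show ?thesis
      unfolding R_adj B_block B3_eq using P'(1,2) PD
      by (simp, subst mult_four_block_mat[of _ 1 1 _ m _ m _ _ 1 _ m])
        (auto simp: left_mult_zero_mat[OF P'(2)] right_mult_zero_mat[OF PD] right_mult_one_mat[of _ 1 1])
  qed
  ultimately have "A = (W * R) * mat_diag n ((!) (e # es)) * mat_adjoint (W * R)"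
    using W'(1,2) R mat_diag_dim[of n "(!) (e # es)"]
    by (simp add: A_eq mat_adjoint_mult[OF W'(1) R])
  then show ?case
    using unitary_mat_mult[OF W \<open>unitary_mat n R\<close>] len n by auto
qed

section \<open>Eigenvalue inequalities\<close>

lemma proots_prod_list_linear_factors:
  fixes es :: "complex list"
  shows "proots (\<Prod>e\<leftarrow>es. [:- e, 1:]) = mset es"
proof (induction es)
  case (Cons e es)
  have "(\<Prod>e\<leftarrow>es. [:- e, 1:]) \<noteq> 0"
    by (auto simp: prod_list_zero_iff)
  then have "proots ([:- e, 1:] * (\<Prod>e\<leftarrow>es. [:- e, 1:])) = {#e#} + mset es"
    by (subst proots_mult) (simp_all add: Cons)
  then show ?case
    by (simp del: mult_pCons_left)
qed simp

text \<open>Two diagonalizations are used. The first, with the roots in an arbitrary order, shows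
  that they are real; the second uses the sorted list of their real parts, which by then is known to
  factor the same characteristic polynomial.\<close>

lemma hermitian_spectral:
  fixes A :: "complex mat"
  assumes A: "A \<in> carrier_mat n n" "mat_adjoint A = A"
  shows "length (sorted_eigenvalues A) = n"
    and "\<exists>P. unitary_mat n P \<and>
      A = P * mat_diag n (\<lambda>i. of_real (sorted_eigenvalues A ! i)) * mat_adjoint P"
proof -
  obtain es where es: "char_poly A = (\<Prod>e\<leftarrow>es. [:- e, 1:])"
    using char_poly_factorized[OF A(1)] by auto
  obtain P where P: "unitary_mat n P" and A_eq: "A = P * mat_diag n ((!) es) * mat_adjoint P"
    and len: "length es = n"
    using hermitian_unitary_diagonalization[OF A es] by auto
  note P' = unitary_matD[OF P]
  note [simp] = assoc_mult_mat[of _ n n _ n _ n] mult_carrier_mat[of _ n n _ n]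
  have "mat_adjoint P * A * P = (mat_adjoint P * P) * mat_diag n ((!) es) * (mat_adjoint P * P)"
    unfolding A_eq using P'(1,2) mat_diag_dim[of n "(!) es"] by simp
  then have D: "mat_adjoint P * A * P = mat_diag n ((!) es)"
    using mat_diag_dim[of n "(!) es"] by (simp add: P')
  \<comment> \<open>Unitary conjugation preserves self-adjointness, so the diagonal matrix of the
    roots equals its own conjugate.\<close>
  have "mat_adjoint (mat_adjoint P * A * P) = mat_adjoint P * A * P"
    using A P'(1,2) by (simp add: mat_adjoint_mult[of _ n n _ n])
  then have D_adj: "mat_adjoint (mat_diag n ((!) es)) = mat_diag n ((!) es)"
    unfolding D .
  have real: "complex_of_real (Re e) = e" if "e \<in> set es" for e
  proof -
    obtain i where i: "i < n" "e = es ! i"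
      using \<open>e \<in> set es\<close> len by (auto simp: in_set_conv_nth)
    then have "cnj e = e"
      using arg_cong[OF D_adj, of "\<lambda>M. M $$ (i, i)"] by (simp add: mat_diag_def)
    then show ?thesis
      by (simp add: complex_eq_iff)
  qed
  define ls where "ls = sorted_eigenvalues A"
  have mset_ls: "mset ls = image_mset Re (mset es)"
    by (simp add: ls_def sorted_eigenvalues_def es proots_prod_list_linear_factors)
  have "length ls = size (mset ls)"
    by simp
  also have "\<dots> = n"
    by (simp add: mset_ls len)
  finally show length_ls: "length (sorted_eigenvalues A) = n"
    by (simp add: ls_def)
  \<comment> \<open>As the roots are real, neither taking real parts nor sorting changes the
    multiset of linear factors.\<close>
  have "mset (map complex_of_real ls) = image_mset (complex_of_real \<circ> Re) (mset es)"
    by (simp add: mset_ls image_mset.compositionality)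
  also have "\<dots> = mset es"
    using image_mset_cong[of "mset es" "complex_of_real \<circ> Re" id] real by (simp add: comp_def)
  finally have "mset (map (\<lambda>e. [:- e, 1:]) (map complex_of_real ls)) = mset (map (\<lambda>e. [:- e, 1:]) es)"
    by (simp only: mset_map)
  then have "char_poly A = (\<Prod>e\<leftarrow>map complex_of_real ls. [:- e, 1:])"
    unfolding es by (metis prod_mset_prod_list)
  then obtain P where "unitary_mat n P"
    "A = P * mat_diag n ((!) (map complex_of_real ls)) * mat_adjoint P"
    using hermitian_unitary_diagonalization[OF A] by blast
  moreover have "mat_diag n ((!) (map complex_of_real ls)) = mat_diag n (\<lambda>i. of_real (ls ! i))"
    using length_ls by (intro eq_matI) (auto simp: mat_diag_def ls_def)
  ultimately show "\<exists>P. unitary_mat n P \<and>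
      A = P * mat_diag n (\<lambda>i. of_real (sorted_eigenvalues A ! i)) * mat_adjoint P"
    unfolding ls_def by auto
qed

lemma sorted_sorted_eigenvalues: "sorted (sorted_eigenvalues A)"
  by (simp add: sorted_eigenvalues_def)

text \<open>Invariance of the trace: after exchanging the two sums, each eigenvalue is multiplied by
  the squared norm of a column of \<open>P\<close>, which is 1.\<close>

lemma sum_sorted_eigenvalues:
  assumes A: "A \<in> carrier_mat n n" "mat_adjoint A = A"
  shows "(\<Sum>i<n. sorted_eigenvalues A ! i) = (\<Sum>i<n. Re (A $$ (i, i)))"
proof -
  define l where "l i = sorted_eigenvalues A ! i" for i
  obtain P where P: "unitary_mat n P"
    and A_eq: "A = P * mat_diag n (\<lambda>i. of_real (l i)) * mat_adjoint P"
    using hermitian_spectral(2)[OF A] by (auto simp: l_def)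
  note P' = unitary_matD[OF P]
  have "A $$ (i, i) = (\<Sum>k<n. P $$ (i, k) * of_real (l k) * cnj (P $$ (i, k)))" if "i < n" for i
    using P' that by (simp add: A_eq mat_diag_mult_right[OF P'(1)] scalar_prod_def atLeast0LessThan)
  then have "(\<Sum>i<n. A $$ (i, i)) = (\<Sum>i<n. \<Sum>k<n. P $$ (i, k) * of_real (l k) * cnj (P $$ (i, k)))"
    by simp
  also have "\<dots> = (\<Sum>k<n. \<Sum>i<n. P $$ (i, k) * of_real (l k) * cnj (P $$ (i, k)))"
    by (rule sum.swap)
  also have "\<dots> = (\<Sum>k<n. of_real (l k) * (mat_adjoint P * P) $$ (k, k))"
    using P'(1) by (auto simp: scalar_prod_def atLeast0LessThan sum_distrib_left mult_ac intro!: sum.cong)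
  also have "\<dots> = of_real (\<Sum>k<n. l k)"
    by (simp add: P')
  finally show ?thesis
    by (metis (no_types, lifting) Re_complex_of_real Re_sum l_def sum.cong)
qed

section \<open>Quadratic forms in an eigenbasis and comparison of eigenvalues\<close>

lemma diag_cscalar_prod:
  assumes "y \<in> carrier_vec n"
  shows "(mat_diag n (\<lambda>i. complex_of_real (l i)) *\<^sub>v y) \<bullet>c y = of_real (\<Sum>i<n. l i * (cmod (y $ i))\<^sup>2)"
proof -
  have "(mat_diag n (\<lambda>i. complex_of_real (l i)) *\<^sub>v y) $ i = of_real (l i) * y $ i" if "i < n" for i
    using assms that by (simp add: mat_diag_def scalar_prod_def if_distrib if_distribR sum.delta cong: if_cong)
  then have "(mat_diag n (\<lambda>i. complex_of_real (l i)) *\<^sub>v y) \<bullet>c y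
      = (\<Sum>i<n. of_real (l i) * y $ i * cnj (y $ i))"
    using assms by (auto simp: scalar_prod_def atLeast0LessThan intro!: sum.cong)
  also have "\<dots> = (\<Sum>i<n. of_real (l i * (cmod (y $ i))\<^sup>2))"
    by (simp add: mult.assoc flip: complex_norm_square)
  finally show ?thesis
    by simp
qed

lemma spectral_quadratic_form:
  assumes A: "A = P * mat_diag n (\<lambda>i. complex_of_real (l i)) * mat_adjoint P"
    and P: "unitary_mat n P" and y: "y \<in> carrier_vec n"
  shows "(A *\<^sub>v (P *\<^sub>v y)) \<bullet>c (P *\<^sub>v y) = of_real (\<Sum>i<n. l i * (cmod (y $ i))\<^sup>2)"
proof -
  note P' = unitary_matD[OF P]
  let ?D = "mat_diag n (\<lambda>i. complex_of_real (l i))"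
  have "A *\<^sub>v (P *\<^sub>v y) = P *\<^sub>v (?D *\<^sub>v ((mat_adjoint P * P) *\<^sub>v y))"
    unfolding A using P'(1,2) y mat_diag_dim[of n "\<lambda>i. complex_of_real (l i)"]
    by (simp add: assoc_mult_mat_vec[of _ n n _ n] mult_carrier_mat[of _ n n _ n]
        mult_mat_vec_carrier[of _ n n])
  also have "\<dots> = P *\<^sub>v (?D *\<^sub>v y)"
    using y by (simp add: P')
  finally show ?thesis
    using unitary_mat_cscalar_prod[OF P, of "?D *\<^sub>v y" y] y mat_diag_dim[of n "\<lambda>i. complex_of_real (l i)"]
    by (simp add: diag_cscalar_prod mult_mat_vec_carrier[of _ n n])
qed

text \<open>Weyl monotonicity by the dimension count of Courant and Fischer. The eigenvectors of
  \<open>A\<close> numbered from \<open>k\<close> on span dimension \<open>n - k\<close>, those of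
  \<open>B\<close> numbered up to \<open>k\<close> span dimension \<open>k + 1\<close>, so the spans
  share some \<open>x\<close> other than zero. The Rayleigh quotient at \<open>x\<close> is at least
  the \<open>k\<close>-th eigenvalue of \<open>A\<close> and at most that of
  \<open>B\<close>.\<close>

lemma sorted_eigenvalues_mono:
  assumes A: "A \<in> carrier_mat n n" "mat_adjoint A = A"
    and B: "B \<in> carrier_mat n n" "mat_adjoint B = B"
    and le: "\<And>x. x \<in> carrier_vec n \<Longrightarrow> Re ((A *\<^sub>v x) \<bullet>c x) \<le> Re ((B *\<^sub>v x) \<bullet>c x)"
    and k: "k < n"
  shows "sorted_eigenvalues A ! k \<le> sorted_eigenvalues B ! k"
proof -
  define a where "a i = sorted_eigenvalues A ! i" for i
  define b where "b i = sorted_eigenvalues B ! i" for i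
  obtain P where P: "unitary_mat n P"
    and A_eq: "A = P * mat_diag n (\<lambda>i. of_real (a i)) * mat_adjoint P"
    using hermitian_spectral(2)[OF A] by (auto simp: a_def)
  obtain R where R: "unitary_mat n R"
    and B_eq: "B = R * mat_diag n (\<lambda>i. of_real (b i)) * mat_adjoint R"
    using hermitian_spectral(2)[OF B] by (auto simp: b_def)
  note P' = unitary_matD[OF P] and R' = unitary_matD[OF R]
  have a_mono: "a i \<le> a j" if "i \<le> j" "j < n" for i j
    using that hermitian_spectral(1)[OF A] by (auto simp: a_def intro: sorted_nth_mono sorted_sorted_eigenvalues)
  have b_mono: "b i \<le> b j" if "i \<le> j" "j < n" for i j
    using that hermitian_spectral(1)[OF B] by (auto simp: b_def intro: sorted_nth_mono sorted_sorted_eigenvalues)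
  \<comment> \<open>Change of coordinates: a vector with coordinates \<open>y\<close> in the
    eigenbasis of \<open>A\<close> has coordinates \<open>U *\<^sub>v y\<close> in that of
    \<open>B\<close>.\<close>
  define U where "U = mat_adjoint R * P"
  have U: "U \<in> carrier_mat n n"
    using P' R' by (auto simp: U_def)
  \<comment> \<open>The rows below \<open>k\<close> force the coordinates of a kernel vector \<open>y\<close> below \<open>k\<close> to vanish, the rows
    above \<open>k\<close> those of \<open>U *\<^sub>v y\<close> above \<open>k\<close>; since row \<open>k\<close> is free, such a vector \<open>y \<noteq> 0\<close> exists.\<close>
  define c where "c i = (if i < k then unit_vec n i else row U i)" for i
  define K where "K = mat\<^sub>r n n (\<lambda>i. if i = k then 0\<^sub>v n else c i)"
  have c: "c i \<in> carrier_vec n" if "i < n" for i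
    using U that by (auto simp: c_def)
  have "Determinant.det K = 0"
    unfolding K_def using c k by (intro det_row_0) auto
  moreover have K: "K \<in> carrier_mat n n"
    by (simp add: K_def)
  ultimately obtain y where y: "y \<in> carrier_vec n" "y \<noteq> 0\<^sub>v n" "K *\<^sub>v y = 0\<^sub>v n"
    using det_0_iff_vec_prod_zero_field by blast
  define z where "z = U *\<^sub>v y"
  have row: "c i \<bullet> y = 0" if "i < n" "i \<noteq> k" for i
    using arg_cong[OF y(3), of "\<lambda>v. vec_index v i"] that K c[OF that(1)] by (simp add: K_def)
  have y0: "y $ i = 0" if "i < k" for i
    using row[of i] that k y(1) by (simp add: c_def)
  have z0: "z $ i = 0" if "k < i" "i < n" for i
    using row[of i] that U by (simp add: c_def z_def)
  have z: "z \<in> carrier_vec n"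
    using U y by (simp add: z_def)
  define x where "x = P *\<^sub>v y"
  have x: "x \<in> carrier_vec n"
    using P' y by (simp add: x_def)
  have "R *\<^sub>v z = (R * mat_adjoint R) *\<^sub>v x"
    unfolding z_def U_def x_def using P'(1,2) R'(1,2) y(1)
    by (simp add: assoc_mult_mat_vec[of _ n n _ n] mult_mat_vec_carrier[of _ n n])
  then have xz: "x = R *\<^sub>v z"
    using x by (simp add: R')
  have norm_y: "y \<bullet>c y = of_real (\<Sum>i<n. (cmod (y $ i))\<^sup>2)" if "y \<in> carrier_vec n" for y
    using that by (auto simp: scalar_prod_def atLeast0LessThan simp flip: complex_norm_square of_real_power intro!: sum.cong)
  \<comment> \<open>Both coordinate vectors have the norm of \<open>x\<close>, so the sums of
    squares weighting the two eigenvalues below are equal and positive and can be cancelled.\<close>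
  have "x \<bullet>c x = y \<bullet>c y" "x \<bullet>c x = z \<bullet>c z"
    using unitary_mat_cscalar_prod[OF P y(1) y(1)] unitary_mat_cscalar_prod[OF R z z]
    by (simp_all add: x_def[symmetric] xz[symmetric])
  then have "(\<Sum>i<n. (cmod (y $ i))\<^sup>2) = (\<Sum>i<n. (cmod (z $ i))\<^sup>2)"
    by (metis norm_y of_real_eq_iff y(1) z)
  moreover have "(\<Sum>i<n. (cmod (y $ i))\<^sup>2) > 0"
  proof -
    obtain i where "i < n" "y $ i \<noteq> 0"
      using y(1,2) by (metis carrier_vecD eq_vecI index_zero_vec(1) index_zero_vec(2))
    then show ?thesis
      by (intro sum_pos2[of _ i]) auto
  qed
  moreover have "a k * (\<Sum>i<n. (cmod (y $ i))\<^sup>2) \<le> b k * (\<Sum>i<n. (cmod (z $ i))\<^sup>2)"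
  proof -
    have "a k * (\<Sum>i<n. (cmod (y $ i))\<^sup>2) \<le> (\<Sum>i<n. a i * (cmod (y $ i))\<^sup>2)"
      unfolding sum_distrib_left
    proof (rule sum_mono)
      fix i assume "i \<in> {..<n}"
      then show "a k * (cmod (y $ i))\<^sup>2 \<le> a i * (cmod (y $ i))\<^sup>2"
        using a_mono[of k i] y0[of i] by (cases "i < k") (auto intro: mult_right_mono)
    qed
    also have "\<dots> = Re ((A *\<^sub>v x) \<bullet>c x)"
      using spectral_quadratic_form[OF A_eq P y(1)] by (simp add: x_def)
    also have "\<dots> \<le> Re ((B *\<^sub>v x) \<bullet>c x)"
      by (rule le[OF x])
    also have "\<dots> = (\<Sum>i<n. b i * (cmod (z $ i))\<^sup>2)"
      using spectral_quadratic_form[OF B_eq R z] by (simp add: xz)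
    also have "\<dots> \<le> b k * (\<Sum>i<n. (cmod (z $ i))\<^sup>2)"
      unfolding sum_distrib_left
    proof (rule sum_mono)
      fix i assume "i \<in> {..<n}"
      then show "b i * (cmod (z $ i))\<^sup>2 \<le> b k * (cmod (z $ i))\<^sup>2"
        using b_mono[of i k] z0[of i] k by (cases "k < i") (auto intro: mult_right_mono)
    qed
    finally show ?thesis .
  qed
  ultimately show ?thesis
    by (simp add: a_def b_def)
qed

section \<open>Eigenvalue differences bounded by the entrywise norm\<close>

lemma sum_abs_sorted_eigenvalues_diff_le:
  assumes A: "A \<in> carrier_mat n n" "mat_adjoint A = A"
    and B: "B \<in> carrier_mat n n" "mat_adjoint B = B"
  shows "(\<Sum>k<n. \<bar>sorted_eigenvalues A ! k - sorted_eigenvalues B ! k\<bar>) \<le> entry_norm (A - B)"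
proof -
  define w where "w i j = cmod (A $$ (i, j) - B $$ (i, j))" for i j
  have norm_eq: "entry_norm (A - B) = (\<Sum>i<n. \<Sum>j<n. w i j)"
    using A B by (auto simp: entry_norm_def w_def)
  have A_cnj: "cnj (A $$ (i, j)) = A $$ (j, i)" if "i < n" "j < n" for i j
    using arg_cong[OF A(2), of "\<lambda>M. M $$ (j, i)"] A(1) that by simp
  have B_cnj: "cnj (B $$ (i, j)) = B $$ (j, i)" if "i < n" "j < n" for i j
    using arg_cong[OF B(2), of "\<lambda>M. M $$ (j, i)"] B(1) that by simp
  have w_sym: "w i j = w j i" if "i < n" "j < n" for i j
    using A_cnj[of i j] B_cnj[of i j] that by (metis complex_cnj_diff complex_mod_cnj w_def)
  define M where "M = Matrix.mat n n (\<lambda>(i, j). (A $$ (i, j) + B $$ (i, j)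
    + (if i = j then of_real (\<Sum>k<n. w i k) else 0)) / 2)"
  have M: "M \<in> carrier_mat n n" "mat_adjoint M = M"
    using A_cnj B_cnj by (auto simp: M_def intro!: eq_matI)
  have qf: "(X *\<^sub>v x) \<bullet>c x = (\<Sum>i<n. \<Sum>j<n. X $$ (i, j) * x $ j * cnj (x $ i))"
    if "X \<in> carrier_mat n n" "x \<in> carrier_vec n" for X x
    using that by (auto simp: scalar_prod_def sum_distrib_right atLeast0LessThan intro!: sum.cong)
  \<comment> \<open>Stated for \<open>X\<close> and \<open>Y\<close> so that it serves both orders
    of \<open>A\<close> and \<open>B\<close>: their sum, \<open>w\<close> and hence \<open>M\<close>
    are symmetric in the two. With \<open>V\<close> the difference of \<open>X\<close> and
    \<open>Y\<close>, twice \<open>M - X\<close> is the diagonal of row sums of \<open>w\<close>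
    minus \<open>V\<close>.\<close>
  have dominant: "Re ((X *\<^sub>v x) \<bullet>c x) \<le> Re ((M *\<^sub>v x) \<bullet>c x)"
    if X: "X \<in> carrier_mat n n" and Y: "Y \<in> carrier_mat n n"
      and XY: "\<And>i j. i < n \<Longrightarrow> j < n \<Longrightarrow> A $$ (i, j) + B $$ (i, j) = X $$ (i, j) + Y $$ (i, j)"
      and w: "\<And>i j. i < n \<Longrightarrow> j < n \<Longrightarrow> w i j = cmod (X $$ (i, j) - Y $$ (i, j))"
      and x: "x \<in> carrier_vec n" for X Y x
  proof -
    define V where "V i j = X $$ (i, j) - Y $$ (i, j)" for i j
    have "(M *\<^sub>v x) \<bullet>c x - (X *\<^sub>v x) \<bullet>c x
      = (\<Sum>i<n. \<Sum>j<n. ((if i = j then of_real (\<Sum>k<n. w i k) else 0) - V i j) / 2 * x $ j * cnj (x $ i))"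
      unfolding qf[OF X x] qf[OF M(1) x] sum_subtractf[symmetric]
    proof (intro sum.cong refl)
      fix i j assume "i \<in> {..<n}" "j \<in> {..<n}"
      then have "M $$ (i, j) = (X $$ (i, j) + Y $$ (i, j) + (if i = j then of_real (\<Sum>k<n. w i k) else 0)) / 2"
        by (simp add: M_def XY)
      then show "M $$ (i, j) * x $ j * cnj (x $ i) - X $$ (i, j) * x $ j * cnj (x $ i)
          = ((if i = j then of_real (\<Sum>k<n. w i k) else 0) - V i j) / 2 * x $ j * cnj (x $ i)"
        by (simp add: V_def diff_divide_distrib add_divide_distrib algebra_simps)
    qed
    also have "\<dots> = (\<Sum>i<n. \<Sum>j<n. (if i = j then of_real (\<Sum>k<n. w i k) / 2 * x $ j * cnj (x $ i) else 0)
        - V i j / 2 * x $ j * cnj (x $ i))"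
      by (intro sum.cong refl) (simp add: field_simps)
    also have "\<dots> = (\<Sum>i<n. of_real (\<Sum>k<n. w i k) / 2 * x $ i * cnj (x $ i))
        - (\<Sum>i<n. \<Sum>j<n. V i j / 2 * x $ j * cnj (x $ i))"
      by (simp add: sum_subtractf)
    also have "(\<Sum>i<n. of_real (\<Sum>k<n. w i k) / 2 * x $ i * cnj (x $ i))
        = of_real (\<Sum>i<n. \<Sum>k<n. w i k * (cmod (x $ i))\<^sup>2 / 2)"
      by (simp add: sum_distrib_right sum_divide_distrib mult.assoc flip: complex_norm_square)
    finally have diff: "Re ((M *\<^sub>v x) \<bullet>c x) - Re ((X *\<^sub>v x) \<bullet>c x)
        = (\<Sum>i<n. \<Sum>k<n. w i k * (cmod (x $ i))\<^sup>2 / 2)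
          - (\<Sum>i<n. \<Sum>j<n. Re (V i j / 2 * x $ j * cnj (x $ i)))"
      by (metis (no_types, lifting) Re_complex_of_real Re_sum minus_complex.simps(1) sum.cong)
    \<comment> \<open>Diagonal dominance: by the inequality between product and squares, the entry
      at \<open>i\<close>, \<open>j\<close> is charged half to coordinate \<open>i\<close> and half
      to coordinate \<open>j\<close>.\<close>
    have "(\<Sum>i<n. \<Sum>j<n. Re (V i j / 2 * x $ j * cnj (x $ i)))
        \<le> (\<Sum>i<n. \<Sum>j<n. w i j * (cmod (x $ i))\<^sup>2 / 4 + w i j * (cmod (x $ j))\<^sup>2 / 4)"
    proof (intro sum_mono)
      fix i j assume ij: "i \<in> {..<n}" "j \<in> {..<n}"
      have "Re (V i j / 2 * x $ j * cnj (x $ i)) \<le> cmod (V i j / 2 * x $ j * cnj (x $ i))"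
        by (rule complex_Re_le_cmod)
      also have "\<dots> = w i j / 4 * (2 * cmod (x $ i) * cmod (x $ j))"
        using ij w by (simp add: norm_mult norm_divide V_def)
      also have "\<dots> \<le> w i j / 4 * ((cmod (x $ i))\<^sup>2 + (cmod (x $ j))\<^sup>2)"
        by (intro mult_left_mono sum_squares_bound) (simp add: w_def)
      finally show "Re (V i j / 2 * x $ j * cnj (x $ i))
          \<le> w i j * (cmod (x $ i))\<^sup>2 / 4 + w i j * (cmod (x $ j))\<^sup>2 / 4"
        by (simp add: algebra_simps)
    qed
    also have "\<dots> = (\<Sum>i<n. \<Sum>j<n. w i j * (cmod (x $ i))\<^sup>2 / 4)
        + (\<Sum>i<n. \<Sum>j<n. w i j * (cmod (x $ j))\<^sup>2 / 4)"
      by (simp add: sum.distrib)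
    \<comment> \<open>Exchanging the sums and using the symmetry of \<open>w\<close> makes both
      halves equal; together they are exactly the contribution of the row sums.\<close>
    also have "(\<Sum>i<n. \<Sum>j<n. w i j * (cmod (x $ j))\<^sup>2 / 4)
        = (\<Sum>j<n. \<Sum>i<n. w i j * (cmod (x $ j))\<^sup>2 / 4)"
      by (rule sum.swap)
    also have "\<dots> = (\<Sum>i<n. \<Sum>j<n. w i j * (cmod (x $ i))\<^sup>2 / 4)"
      using w_sym by (intro sum.cong) auto
    also have "(\<Sum>i<n. \<Sum>j<n. w i j * (cmod (x $ i))\<^sup>2 / 4) + \<dots>
        = (\<Sum>i<n. \<Sum>k<n. w i k * (cmod (x $ i))\<^sup>2 / 2)"
      by (simp flip: sum.distrib)
    finally show ?thesis
      using diff by simp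
  qed
  have A_le: "sorted_eigenvalues A ! k \<le> sorted_eigenvalues M ! k" if "k < n" for k
    using dominant[OF A(1) B(1)] that by (intro sorted_eigenvalues_mono[OF A M]) (auto simp: w_def)
  have B_le: "sorted_eigenvalues B ! k \<le> sorted_eigenvalues M ! k" if "k < n" for k
    using dominant[OF B(1) A(1)] that
    by (intro sorted_eigenvalues_mono[OF B M]) (auto simp: w_def norm_minus_commute)
  have "(\<Sum>k<n. \<bar>sorted_eigenvalues A ! k - sorted_eigenvalues B ! k\<bar>)
      \<le> (\<Sum>k<n. 2 * sorted_eigenvalues M ! k - sorted_eigenvalues A ! k - sorted_eigenvalues B ! k)"
  proof (rule sum_mono)
    fix k assume "k \<in> {..<n}"
    then show "\<bar>sorted_eigenvalues A ! k - sorted_eigenvalues B ! k\<bar>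
        \<le> 2 * sorted_eigenvalues M ! k - sorted_eigenvalues A ! k - sorted_eigenvalues B ! k"
      using A_le[of k] B_le[of k] by auto
  qed
  \<comment> \<open>The absolute values are gone, so the eigenvalue sums become traces; in the
    combination of traces only the row sums of \<open>w\<close> survive.\<close>
  also have "\<dots> = 2 * (\<Sum>k<n. Re (M $$ (k, k))) - (\<Sum>k<n. Re (A $$ (k, k))) - (\<Sum>k<n. Re (B $$ (k, k)))"
    by (simp add: sum_subtractf sum_sorted_eigenvalues[OF A] sum_sorted_eigenvalues[OF B]
        sum_sorted_eigenvalues[OF M] flip: sum_distrib_left)
  also have "\<dots> = entry_norm (A - B)"
    unfolding norm_eq sum_distrib_left sum_subtractf[symmetric]
    by (intro sum.cong) (auto simp: M_def add_divide_distrib)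
  finally show ?thesis .
qed

section \<open>Floquet matrices\<close>

context periodic_graph
begin

section \<open>Lattice translations and edge indices\<close>

lemma representation_lattice_vec:
  "representation (range (period G)) (lattice_vec G m) (period G s) = of_int (vec_nth m s)"
proof -
  have "representation (range (period G)) (lattice_vec G m) (period G s)
      = (\<Sum>t\<in>UNIV. of_int (vec_nth m t) * representation (range (period G)) (period G t) (period G s))"
    unfolding lattice_vec_def
    by (simp add: representation_sum representation_scale independent_period span_period)
  \<comment> \<open>Injectivity of \<open>period G\<close> ensures that different numbers
    \<open>t\<close> and \<open>s\<close> denote different basis vectors.\<close>
  also have "\<dots> = (\<Sum>t\<in>UNIV. of_int (vec_nth m t) * (if t = s then 1 else 0))"
    by (simp add: representation_basis independent_period inj_eq[OF inj_period] eq_commute[of s] cong: if_cong)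
  finally show ?thesis
    by (simp add: if_distrib cong: if_cong)
qed

lemma coord_add_lattice_vec: "coord G (v + lattice_vec G m) s = coord G v s + of_int (vec_nth m s)"
proof -
  have "v + lattice_vec G m - origin G = (v - origin G) + lattice_vec G m"
    by simp
  then show ?thesis
    unfolding coord_def
    by (simp only: representation_add[OF independent_period] span_period UNIV_I representation_lattice_vec)
qed

text \<open>A lattice translation adds integers to the coordinates, and floors move along. Both end
  points of an edge gain the same \<open>m\<close>, which is why the index is constant on
  orbits.\<close>

lemma int_part_add_lattice_vec: "int_part G (v + lattice_vec G m) = int_part G v + m"
  by (simp add: Finite_Cartesian_Product.vec_eq_iff int_part_def coord_add_lattice_vec)

lemma index_shift:
  "e \<in> arcs (graph G) \<Longrightarrow> index G (shift G m e) = index G e"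
  by (simp add: index_def head_shift tail_shift int_part_add_lattice_vec)

lemma orbit_index_edge_orbit:
  assumes "e \<in> arcs (graph G)"
  shows "orbit_index G (edge_orbit G e) = index G e"
proof -
  have "index G ` edge_orbit G e = {index G e}"
    using assms by (auto simp: edge_orbit_def index_shift image_image)
  then show ?thesis
    by (simp add: orbit_index_def)
qed

section \<open>Edge reversal on the fundamental graph and self-adjointness\<close>

lemma edge_orbit_flip:
  assumes "e \<in> arcs (graph G)"
  shows "edge_orbit G (flip G e) = flip G ` edge_orbit G e"
  using assms by (simp add: edge_orbit_def image_image flip_shift)

lemma edge_orbit_subset:
  "X \<in> arcs (fundamental_graph G) \<Longrightarrow> X \<subseteq> arcs (graph G)"
  by (auto simp: fundamental_graph_def edge_orbit_def shift_arcs)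

text \<open>Reversal commutes with translations and therefore acts on orbits, exchanging end points
  and negating the index. The last claim makes this action an involution, as the reindexing of the
  Floquet sums requires.\<close>

lemma fundamental_graph_flip:
  assumes X: "X \<in> arcs (fundamental_graph G)"
  shows "flip G ` X \<in> arcs (fundamental_graph G)"
    and "tail (fundamental_graph G) (flip G ` X) = head (fundamental_graph G) X"
    and "head (fundamental_graph G) (flip G ` X) = tail (fundamental_graph G) X"
    and "orbit_index G (flip G ` X) = - orbit_index G X"
    and "flip G ` flip G ` X = X"
proof -
  obtain e where e: "e \<in> arcs (graph G)" "X = edge_orbit G e"
    using X by (auto simp: fundamental_graph_def)
  then show "flip G ` X \<in> arcs (fundamental_graph G)"
    by (auto simp: fundamental_graph_def edge_orbit_flip[symmetric])
  show "orbit_index G (flip G ` X) = - orbit_index G X"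
    using e by (simp add: edge_orbit_flip[symmetric] orbit_index_edge_orbit index_def)
  \<comment> \<open>The sets under \<open>the_elem\<close> on the two sides coincide, since the tail
    of a reversed edge is the head of the edge.\<close>
  show "tail (fundamental_graph G) (flip G ` X) = head (fundamental_graph G) X"
    using edge_orbit_subset[OF X] unfolding fundamental_graph_def
    by (auto simp: image_image intro!: arg_cong[where f = the_elem] image_cong)
  show "head (fundamental_graph G) (flip G ` X) = tail (fundamental_graph G) X"
    using edge_orbit_subset[OF X] unfolding fundamental_graph_def
    by (auto simp: image_image intro!: arg_cong[where f = the_elem] image_cong)
  show "flip G ` flip G ` X = X"
    by (simp add: image_image)
qed

text \<open>Reversal carries the oriented edges counted in one entry bijectively to those of the
  transposed entry, and the negated index conjugates the exponential. The degrees are real and sit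
  on the diagonal.\<close>

lemma floquet_laplacian_hermitian:
  "mat_adjoint (floquet_laplacian G vs \<theta>) = floquet_laplacian G vs \<theta>"
proof (rule eq_matI)
  let ?F = "fundamental_graph G"
  define S where "S u v = {X \<in> arcs ?F. tail ?F X = u \<and> head ?F X = v}" for u v
  define E where "E X = exp (\<i> * of_real (\<Sum>s\<in>UNIV. of_int (vec_nth (orbit_index G X) s) * vec_nth \<theta> s))" for X
  fix i j assume "i < dim_row (floquet_laplacian G vs \<theta>)" "j < dim_col (floquet_laplacian G vs \<theta>)"
  then have ij: "i < length vs" "j < length vs"
    by (simp_all add: floquet_laplacian_def)
  have entry: "floquet_laplacian G vs \<theta> $$ (i, j)
      = (if i = j then of_nat (out_degree (graph G) (vs ! i)) else 0) - (\<Sum>X\<in>S (vs ! i) (vs ! j). E X)"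
    if "i < length vs" "j < length vs" for i j
    using that by (simp add: floquet_laplacian_def S_def E_def)
  have dims: "dim_row (floquet_laplacian G vs \<theta>) = length vs" "dim_col (floquet_laplacian G vs \<theta>) = length vs"
    by (simp_all add: floquet_laplacian_def)
  have E_flip: "cnj (E X) = E (flip G ` X)" if "X \<in> arcs ?F" for X
    by (simp add: E_def fundamental_graph_flip(4)[OF that] sum_negf exp_cnj)
  have "cnj (\<Sum>X\<in>S (vs ! j) (vs ! i). E X) = (\<Sum>X\<in>S (vs ! j) (vs ! i). E (flip G ` X))"
    by (auto simp: E_flip S_def intro!: sum.cong)
  also have "\<dots> = (\<Sum>X\<in>S (vs ! i) (vs ! j). E X)"
    by (rule sum.reindex_bij_witness[of _ "image (flip G)" "image (flip G)"])
      (auto simp: S_def fundamental_graph_flip)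
  finally show "mat_adjoint (floquet_laplacian G vs \<theta>) $$ (i, j) = floquet_laplacian G vs \<theta> $$ (i, j)"
    using ij entry[of i j] entry[of j i] dims by (simp del: cnj_sum)
qed (simp_all add: floquet_laplacian_def)

end

section \<open>Floquet matrices of two periodic graphs\<close>

lemma floquet_laplacian_carrier: "floquet_laplacian G vs \<theta> \<in> carrier_mat (length vs) (length vs)"
  by (simp add: floquet_laplacian_def)

lemma floquet_matrix_carrier: "floquet_matrix G Q vs \<theta> \<in> carrier_mat (length vs) (length vs)"
  by (simp add: floquet_matrix_def mat_diag_def)

lemma (in periodic_graph) floquet_matrix_hermitian:
  "mat_adjoint (floquet_matrix G Q vs \<theta>) = floquet_matrix G Q vs \<theta>"
proof (rule eq_matI)
  fix i j assume ij: "i < dim_row (floquet_matrix G Q vs \<theta>)" "j < dim_col (floquet_matrix G Q vs \<theta>)"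
  then have "cnj (floquet_laplacian G vs \<theta> $$ (j, i)) = floquet_laplacian G vs \<theta> $$ (i, j)"
    using arg_cong[OF floquet_laplacian_hermitian, of "\<lambda>M. M $$ (i, j)" vs \<theta>]
      floquet_laplacian_carrier[of G vs \<theta>] floquet_matrix_carrier[of G Q vs \<theta>] by simp
  then show "mat_adjoint (floquet_matrix G Q vs \<theta>) $$ (i, j) = floquet_matrix G Q vs \<theta> $$ (i, j)"
    using ij floquet_matrix_carrier[of G Q vs \<theta>] by (simp add: floquet_matrix_def mat_diag_def)
qed (use floquet_matrix_carrier[of G Q vs \<theta>] in auto)

text \<open>The eigenvalue inequality at an arbitrary pair of quasimomenta; the extremal ones are
  inserted in the final estimate.\<close>

lemma band_function_diff_sum_le:
  assumes "periodic_graph G" "periodic_graph G'" "length vs = n" "length vs' = n"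
  shows "(\<Sum>k<n. \<bar>band_function G Q vs k \<theta> - band_function G' Q' vs' k \<theta>'\<bar>)
    \<le> entry_norm (floquet_matrix G Q vs \<theta> - floquet_matrix G' Q' vs' \<theta>')"
  unfolding band_function_def
  using assms(3,4) floquet_matrix_carrier[of G Q vs \<theta>] floquet_matrix_carrier[of G' Q' vs' \<theta>']
    periodic_graph.floquet_matrix_hermitian[OF assms(1)] periodic_graph.floquet_matrix_hermitian[OF assms(2)]
  by (intro sum_abs_sorted_eigenvalues_diff_le) simp_all

text \<open>Separates the contributions of Laplacian and potential inside each entry, so that the
  two special values of \<open>C\<close> follow by letting one of them vanish.\<close>

lemma entry_norm_floquet_matrix_diff:
  assumes "length vs = n" "length vs' = n"
  shows "entry_norm (floquet_matrix G Q vs \<theta> - floquet_matrix G' Q' vs' \<theta>')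
    = (\<Sum>j<n. \<Sum>k<n. cmod (floquet_laplacian G vs \<theta> $$ (j, k) - floquet_laplacian G' vs' \<theta>' $$ (j, k)
        + (if j = k then of_real (Q (vs ! j) - Q' (vs' ! j)) else 0)))"
  using assms floquet_laplacian_carrier[of G vs \<theta>] floquet_laplacian_carrier[of G' vs' \<theta>']
  by (auto simp: entry_norm_def floquet_matrix_def mat_diag_def algebra_simps
      intro!: sum.cong arg_cong[where f = cmod])

theorem theorem6p1:
  fixes G :: "('d::finite, 'e) embedded_graph"
    and G' :: "('d, 'f) embedded_graph"
    and Q Q' :: "real ^ 'd \<Rightarrow> real"
    and vs vs' :: "(real ^ 'd) list"
    and \<nu> :: nat
    and \<theta>p \<theta>m \<theta>p' \<theta>m' :: "real ^ 'd"
    and C :: real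
  assumes dim: "CARD('d) \<ge> 2"
    and graphs: "periodic_graph G" "periodic_graph G'"
    and numberings: "vertex_numbering G vs" "vertex_numbering G' vs'"
    and same_number: "length vs = \<nu>" "length vs' = \<nu>"
    and potentials: "periodic_potential G Q" "periodic_potential G' Q'"
    and U: "condition_U G Q vs" "condition_U G' Q' vs'"
    and L: "condition_L G Q vs" "condition_L G' Q' vs'"
    and upper: "upper_quasimomentum G Q vs \<theta>p" "upper_quasimomentum G' Q' vs' \<theta>p'"
    and lower: "lower_quasimomentum G Q vs \<theta>m" "lower_quasimomentum G' Q' vs' \<theta>m'"
    and C: "C = entry_norm (floquet_matrix G Q vs \<theta>m - floquet_matrix G' Q' vs' \<theta>m')
              + entry_norm (floquet_matrix G Q vs \<theta>p - floquet_matrix G' Q' vs' \<theta>p')"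
  shows
    "\<bar>band_min G Q vs 0 - band_min G' Q' vs' 0\<bar>
       + \<bar>band_max G Q vs (\<nu> - 1) - band_max G' Q' vs' (\<nu> - 1)\<bar>
       + (\<Sum>n<\<nu> - 1. \<bar>gap_length G Q vs n - gap_length G' Q' vs' n\<bar>) \<le> 2 * C
     \<and> (\<Sum>n<\<nu>. \<bar>band_length G Q vs n - band_length G' Q' vs' n\<bar>) \<le> 2 * C
     \<and> (floquet_laplacian G vs \<theta>p = floquet_laplacian G' vs' \<theta>p' \<and>
         floquet_laplacian G vs \<theta>m = floquet_laplacian G' vs' \<theta>m' \<longrightarrow>
         C = 2 * (\<Sum>n<\<nu>. \<bar>Q (vs ! n) - Q' (vs' ! n)\<bar>))
     \<and> ((\<forall>n<\<nu>. Q (vs ! n) = Q' (vs' ! n)) \<longrightarrow>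
         C = entry_norm (floquet_laplacian G vs \<theta>p - floquet_laplacian G' vs' \<theta>p')
           + entry_norm (floquet_laplacian G vs \<theta>m - floquet_laplacian G' vs' \<theta>m'))"
proof (intro conjI impI)
  define lo where "lo n = \<bar>band_min G Q vs n - band_min G' Q' vs' n\<bar>" for n
  define hi where "hi n = \<bar>band_max G Q vs n - band_max G' Q' vs' n\<bar>" for n
  \<comment> \<open>At a lower quasimomentum all band minima are attained simultaneously, so the sum
    over all bands concerns a single pair of matrices. The same holds for the maxima below.\<close>
  have "(\<Sum>n<\<nu>. lo n) \<le> entry_norm (floquet_matrix G Q vs \<theta>m - floquet_matrix G' Q' vs' \<theta>m')"
    using band_function_diff_sum_le[OF graphs same_number, of Q \<theta>m Q' \<theta>m'] lower same_number
    by (simp add: lo_def lower_quasimomentum_def)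
  moreover have "(\<Sum>n<\<nu>. hi n) \<le> entry_norm (floquet_matrix G Q vs \<theta>p - floquet_matrix G' Q' vs' \<theta>p')"
    using band_function_diff_sum_le[OF graphs same_number, of Q \<theta>p Q' \<theta>p'] upper same_number
    by (simp add: hi_def upper_quasimomentum_def)
  ultimately have sum_le: "(\<Sum>n<\<nu>. lo n) + (\<Sum>n<\<nu>. hi n) \<le> C"
    by (simp add: C)
  \<comment> \<open>Each of the two totals is at most \<open>C\<close>; since \<open>C\<close> is
    nonnegative, they are also at most \<open>2 * C\<close>.\<close>
  have nonneg: "0 \<le> (\<Sum>n<\<nu>. lo n) + (\<Sum>n<\<nu>. hi n)"
    by (auto simp: lo_def hi_def intro!: sum_nonneg add_nonneg_nonneg)
  have "(\<Sum>n<\<nu>. \<bar>band_length G Q vs n - band_length G' Q' vs' n\<bar>) \<le> (\<Sum>n<\<nu>. lo n + hi n)"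
    by (intro sum_mono) (auto simp: band_length_def lo_def hi_def)
  with sum_le nonneg show "(\<Sum>n<\<nu>. \<bar>band_length G Q vs n - band_length G' Q' vs' n\<bar>) \<le> 2 * C"
    by (simp add: sum.distrib)
  have "lo 0 + hi (\<nu> - 1) + (\<Sum>n<\<nu> - 1. \<bar>gap_length G Q vs n - gap_length G' Q' vs' n\<bar>) \<le> 2 * C"
  proof (cases \<nu>)
    case 0
    \<comment> \<open>For \<open>\<nu> = 0\<close> the two junk values \<open>[] ! 0\<close> agree.\<close>
    then have "sorted_eigenvalues (floquet_matrix G Q vs \<theta>) = []"
      "sorted_eigenvalues (floquet_matrix G' Q' vs' \<theta>) = []" for \<theta>
      using hermitian_spectral(1)[OF floquet_matrix_carrier, of G Q vs \<theta>]
        hermitian_spectral(1)[OF floquet_matrix_carrier, of G' Q' vs' \<theta>] same_number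
        graphs[THEN periodic_graph.floquet_matrix_hermitian] by auto
    then have "lo 0 = 0" "hi 0 = 0"
      by (simp_all add: lo_def hi_def band_min_def band_max_def band_function_def)
    with 0 sum_le show ?thesis
      by simp
  next
    case (Suc \<mu>)
    \<comment> \<open>Gap \<open>n\<close> lies between the top of band \<open>n\<close> and the
      bottom of band \<open>Suc n\<close>. Together with \<open>lo 0\<close> and
      \<open>hi (\<nu> - 1)\<close>, the gaps use every edge difference exactly once.\<close>
    have "(\<Sum>n<\<mu>. \<bar>gap_length G Q vs n - gap_length G' Q' vs' n\<bar>) \<le> (\<Sum>n<\<mu>. lo (Suc n) + hi n)"
      by (intro sum_mono) (auto simp: gap_length_def lo_def hi_def)
    moreover have "(\<Sum>n<\<nu>. lo n) = lo 0 + (\<Sum>n<\<mu>. lo (Suc n))"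
      unfolding Suc by (rule sum.lessThan_Suc_shift)
    ultimately show ?thesis
      using sum_le nonneg by (simp add: Suc sum.distrib)
  qed
  then show "\<bar>band_min G Q vs 0 - band_min G' Q' vs' 0\<bar>
       + \<bar>band_max G Q vs (\<nu> - 1) - band_max G' Q' vs' (\<nu> - 1)\<bar>
       + (\<Sum>n<\<nu> - 1. \<bar>gap_length G Q vs n - gap_length G' Q' vs' n\<bar>) \<le> 2 * C"
    by (simp add: lo_def hi_def)
next
  assume "floquet_laplacian G vs \<theta>p = floquet_laplacian G' vs' \<theta>p' \<and>
         floquet_laplacian G vs \<theta>m = floquet_laplacian G' vs' \<theta>m'"
  \<comment> \<open>Only the diagonal entries remain, and they are the same at both quasimomenta;
    hence the factor 2.\<close>
  then show "C = 2 * (\<Sum>n<\<nu>. \<bar>Q (vs ! n) - Q' (vs' ! n)\<bar>)"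
    unfolding C entry_norm_floquet_matrix_diff[OF same_number]
    by (simp add: if_distrib[of cmod] cong: if_cong flip: of_real_diff)
next
  assume "\<forall>n<\<nu>. Q (vs ! n) = Q' (vs' ! n)"
  then show "C = entry_norm (floquet_laplacian G vs \<theta>p - floquet_laplacian G' vs' \<theta>p')
           + entry_norm (floquet_laplacian G vs \<theta>m - floquet_laplacian G' vs' \<theta>m')"
    unfolding C entry_norm_floquet_matrix_diff[OF same_number]
    using same_number by (simp add: entry_norm_def floquet_laplacian_def cong: if_cong)
qed

end
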